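(* Fix an integer $d \ge 2$, and let $\mathcal K(d)$ be the nonnegative-integer-valued random variable defined in the context. Then, as $k \to \infty$, $$\mathbb P(\mathcal K(d) \ge k) \ge \exp\left[-O\left(k^{1/(d-1)}\right)\right];$$ that is, there exist constants $C = C(d) < \infty$ and $k_0 = k_0(d)$ such that $\mathbb P(\mathcal K(d) \ge k) \ge \exp\left[-C\, k^{1/(d-1)}\right]$ for all integers $k \ge k_0$.
   Context: For $\mathbf x, \mathbf y \in \mathbb R^d$, $\mathbf x \prec \mathbf y$ (equivalently $\mathbf y \succ \mathbf x$; "$\mathbf x$ is dominated by $\mathbf y$") means $x_j < y_j$ for every $j$; $z_+ := \sum_{j=1}^d z_j$. A point $\mathbf y$ of a point process $S$ is a maximum of $S$ if $\mathbf y \not\prec \mathbf z$ for all points $\mathbf z$ of $S$. Definition of $\mathcal K(d)$: for $g \in \mathbb R$ let $\mathbf x(g) := (g/d,\dots,g/d) \in \mathbb R^d$ and let $\mathcal K_g$ be the number of maxima dominated by $\mathbf x(g)$ in a nonhomogeneous Poisson point process in $\mathbb R^d$ with intensity function $\mathbf z \mapsto \mathbf 1(\mathbf z \not\succ \mathbf x(g))\, e^{-z_+}$. The law of $\mathcal K(d)$ is the mixture $\mathbb E\,\mathcal L(\mathcal K_G)$ with $G$ standard Gumbel, i.e. $\mathbb P(\mathcal K(d) \ge k) = \int_{-\infty}^\infty \mathbb P(\mathcal K_g \ge k)\, e^{-g}\exp(-e^{-g})\,dg$. *)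

theory Defs
  imports "HOL-Probability.Probability" "HOL-Library.Extended_Nat"
begin

definition dominated :: "real ^ 'n \<Rightarrow> real ^ 'n \<Rightarrow> bool" (infix "\<prec>" 50)
  where "x \<prec> y \<longleftrightarrow> (\<forall>j. x $ j < y $ j)"

definition coord_sum :: "real ^ 'n \<Rightarrow> real"
  where "coord_sum z = (\<Sum>j\<in>UNIV. z $ j)"

definition maxima :: "(real ^ 'n) set \<Rightarrow> (real ^ 'n) set"
  where "maxima S = {y \<in> S. \<forall>z\<in>S. \<not> y \<prec> z}"

definition diag_point :: "real \<Rightarrow> real ^ 'n"
  where "diag_point g = (\<chi> j. g / real CARD('n))"

definition ext_card :: "'a set \<Rightarrow> enat"
  where "ext_card A = (if finite A then enat (card A) else \<infinity>)"

text \<open>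
  A Poisson point process on a Euclidean space with a locally finite intensity measure
  \<open>\<Lambda>\<close>. The random configuration is represented by its set of points, hence only simple processes
  are covered; for an intensity measure without atoms, such as the one used below, a Poisson
  process is almost surely simple, so this is no restriction. The Poisson weights are written out
  because \<^const>\<open>poisson_pmf\<close> is specified for positive rates only and \<open>\<Lambda> B = 0\<close> is allowed.
\<close>

definition poisson_point_process ::
    "'w measure \<Rightarrow> 'a::euclidean_space measure \<Rightarrow> ('w \<Rightarrow> 'a set) \<Rightarrow> bool"
  where "poisson_point_process M \<Lambda> N \<longleftrightarrow>
    prob_space M \<and>
    sets \<Lambda> = sets borel \<and>
    (\<forall>B\<in>sets borel. bounded B \<longrightarrow> emeasure \<Lambda> B < \<infinity>) \<and>
    (\<forall>\<omega>\<in>space M. \<forall>B. bounded B \<longrightarrow> finite (N \<omega> \<inter> B)) \<and>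
    (\<forall>B\<in>sets borel. bounded B \<longrightarrow>
      (\<lambda>\<omega>. card (N \<omega> \<inter> B)) \<in> measurable M (count_space UNIV) \<and>
      (\<forall>n. measure M {\<omega> \<in> space M. card (N \<omega> \<inter> B) = n} =
        measure \<Lambda> B ^ n / fact n * exp (- measure \<Lambda> B))) \<and>
    (\<forall>(n::nat) B. (\<forall>i<n. B i \<in> sets borel \<and> bounded (B i)) \<and> disjoint_family_on B {..<n} \<longrightarrow>
      prob_space.indep_vars M (\<lambda>_. count_space UNIV) (\<lambda>i \<omega>. card (N \<omega> \<inter> B i)) {..<n})"

definition intensity :: "real \<Rightarrow> (real ^ 'n) measure"
  where "intensity g =
    density lborel (\<lambda>z. ennreal (indicator {z. \<not> diag_point g \<prec> z} z * exp (- coord_sum z)))"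

text \<open>
  The count \<open>K\<^sub>g\<close> as a functional of the configuration \<open>S\<close>. It is almost surely finite for the
  Poisson process with intensity \<^term>\<open>intensity g\<close>; an infinite count is recorded as \<open>\<infinity>\<close>
  rather than as the conventional cardinality \<open>0\<close>.
\<close>

definition K_count :: "real \<Rightarrow> (real ^ 'n) set \<Rightarrow> enat"
  where "K_count g S = ext_card {y \<in> maxima S. y \<prec> diag_point g}"

definition gumbel_density :: "real \<Rightarrow> real"
  where "gumbel_density g = exp (- g) * exp (- exp (- g))"

text \<open>
  \<open>K\<close> is a random variable on \<open>P\<close> whose law is the Gumbel mixture of the laws of \<open>K\<^sub>g\<close>, where for
  each \<open>g\<close> the count \<open>K\<^sub>g\<close> is realised by a Poisson process \<open>N g\<close> on some probability space
  \<open>M g\<close>. The dimension is \<^term>\<open>CARD('n)\<close>. Only the law of each \<open>N g\<close> matters; no joint law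
  in \<open>g\<close> is involved.
\<close>

definition has_K_law ::
    "'p measure \<Rightarrow> ('p \<Rightarrow> nat) \<Rightarrow> (real \<Rightarrow> 'w measure) \<Rightarrow> (real \<Rightarrow> 'w \<Rightarrow> (real ^ 'n) set) \<Rightarrow> bool"
  where "has_K_law P K M N \<longleftrightarrow>
    prob_space P \<and> K \<in> measurable P (count_space UNIV) \<and>
    (\<forall>g. poisson_point_process (M g) (intensity g) (N g)) \<and>
    (\<forall>k. emeasure P {\<omega> \<in> space P. K \<omega> \<ge> k} =
      (\<integral>\<^sup>+ g. emeasure (M g) {\<omega> \<in> space (M g). K_count g (N g \<omega>) \<ge> enat k}
               * ennreal (gumbel_density g) \<partial>lborel))"

end

theory Submission
  imports Defs
begin

text \<open>
  The mixture is bounded below through atypically large \<open>g\<close>, of order \<open>k powr (1 / (d - 1))\<close>, at the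
  price of a factor \<open>exp (- g)\<close> from the Gumbel density. Near the hyperplane \<open>coord_sum z = 0\<close>, where
  the intensity is of order 1, there is then room below \<open>diag_point g\<close> for a multiple of \<open>k\<close>
  disjoint unit boxes. Each of them contains, with probability bounded below, exactly one point while
  everything else above its lower corner is empty, and such a point is a maximum. Hence at least
  \<open>k\<close> maxima occur with probability bounded below.

  Events of the form \<open>K\<^sub>g \<ge> k\<close> must be shown measurable, since a non-measurable set has the junk
  measure \<open>0\<close>.
\<close>

section \<open>Dominance order and extended cardinality\<close>

lemma not_dominated_self: "\<not> (y :: real ^ 'n) \<prec> y"
  by (simp add: dominated_def)

lemma dominated_trans: "a \<prec> b \<Longrightarrow> b \<prec> c \<Longrightarrow> a \<prec> (c :: real ^ 'n)"
  by (auto simp: dominated_def intro: less_trans)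

lemma open_dominating: "open {z :: real ^ 'n. a \<prec> z}"
  unfolding dominated_def Collect_all_eq
  by (intro open_INT ballI open_Collect_less continuous_intros) auto

lemma open_dominated: "open {z :: real ^ 'n. z \<prec> a}"
  unfolding dominated_def Collect_all_eq
  by (intro open_INT ballI open_Collect_less continuous_intros) auto

lemma borel_dominated:
  "{z :: real ^ 'n. a \<prec> z} \<in> sets borel" "{z :: real ^ 'n. z \<prec> a} \<in> sets borel"
  by (simp_all add: open_dominating open_dominated)

lemma dominated_between:
  \<comment> \<open>The midpoint shows that the open set of points strictly between two comparable
    points is nonempty, so a dense set meets it.\<close>
  fixes y z :: "real ^ 'n"
  assumes "y \<prec> z"
  shows "y \<prec> (1/2) *\<^sub>R (y + z)" "(1/2) *\<^sub>R (y + z) \<prec> z"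
  using assms by (auto simp: dominated_def field_simps)

text \<open>Stated through finite subsets so that an infinite count needs no separate treatment in
  the counting arguments.\<close>

lemma ext_card_ge_iff: "enat k \<le> ext_card A \<longleftrightarrow> (\<exists>F\<subseteq>A. finite F \<and> card F = k)"
proof (cases "finite A")
  case True
  then show ?thesis
    by (auto simp: ext_card_def card_mono dest: finite_subset)
      (metis obtain_subset_with_card_n)
next
  case False
  then show ?thesis
    using infinite_arbitrarily_large[OF False, of k] by (auto simp: ext_card_def)
qed

section \<open>Counts and void events of a Poisson process\<close>

context
  fixes M :: "'w measure" and \<Lambda> :: "'a::euclidean_space measure" and N :: "'w \<Rightarrow> 'a set"
  assumes ppp: "poisson_point_process M \<Lambda> N"
begin

lemma ppp_prob_space: "prob_space M"
  and ppp_locally_finite: "\<omega> \<in> space M \<Longrightarrow> bounded B \<Longrightarrow> finite (N \<omega> \<inter> B)"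
  and ppp_sets: "sets \<Lambda> = sets borel"
  using ppp by (auto simp: poisson_point_process_def)

lemma ppp_card_sets:
  assumes "B \<in> sets borel" "bounded B"
  shows "{\<omega> \<in> space M. P (card (N \<omega> \<inter> B))} \<in> sets M"
proof -
  have "(\<lambda>\<omega>. card (N \<omega> \<inter> B)) \<in> measurable M (count_space UNIV)"
    using ppp assms by (auto simp: poisson_point_process_def)
  then show ?thesis
    using measurable_sets_Collect[of _ M "count_space UNIV" P] by simp
qed

text \<open>The defining clauses only control counts in bounded sets, so \<open>U\<close> is
  exhausted by balls. Local finiteness matters: \<open>card\<close> is 0 on infinite sets too, and
  only for finite sets does 0 mean empty.\<close>

lemma ppp_disjnt_iff:
  assumes "\<omega> \<in> space M"
  shows "N \<omega> \<inter> U = {} \<longleftrightarrow> (\<forall>n::nat. card (N \<omega> \<inter> (U \<inter> cball 0 (real n))) = 0)"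
proof -
  have "finite (N \<omega> \<inter> (U \<inter> cball 0 (real n)))" for n
    by (intro ppp_locally_finite assms bounded_Int disjI2 bounded_cball)
  moreover have "U = (\<Union>n::nat. U \<inter> cball 0 (real n))"
    using real_arch_simple by auto
  ultimately show ?thesis
    by (auto simp: card_eq_0_iff)
qed

lemma ppp_disjnt_sets:
  assumes "U \<in> sets borel"
  shows "{\<omega> \<in> space M. N \<omega> \<inter> U = {}} \<in> sets M"
proof -
  have "{\<omega> \<in> space M. N \<omega> \<inter> U = {}} =
      {\<omega> \<in> space M. \<forall>n::nat. card (N \<omega> \<inter> (U \<inter> cball 0 (real n))) = 0}"
    by (simp add: ppp_disjnt_iff cong: conj_cong)
  also have "\<dots> \<in> sets M"
    using assms by (intro sets.sets_Collect_countable_All ppp_card_sets bounded_Int disjI2) auto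
  finally show ?thesis .
qed

lemma ppp_one_none_sets:
  assumes "Q \<in> sets borel" "bounded Q" "U \<in> sets borel"
  shows "{\<omega> \<in> space M. card (N \<omega> \<inter> Q) = 1 \<and> N \<omega> \<inter> U = {}} \<in> sets M"
  using assms by (intro sets.sets_Collect_conj ppp_card_sets ppp_disjnt_sets)

lemma ppp_one_none_prob_bounded:
  assumes Q: "Q \<in> sets borel" "bounded Q" and B: "B \<in> sets borel" "bounded B"
    and disj: "Q \<inter> B = {}"
  shows "measure M {\<omega> \<in> space M. card (N \<omega> \<inter> Q) = 1 \<and> card (N \<omega> \<inter> B) = 0}
    = measure \<Lambda> Q * exp (- measure \<Lambda> Q) * exp (- measure \<Lambda> B)"
proof -
  interpret prob_space M by (rule ppp_prob_space)
  \<comment> \<open>The pair of sets and the pair of target counts, one and zero, are indexed by 0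
    and 1 to fit the indexed independence clause.\<close>
  define D where "D = (\<lambda>i::nat. if i = 0 then Q else B)"
  define A where "A = (\<lambda>i::nat. {if i = 0 then 1 else 0 :: nat})"
  let ?X = "\<lambda>i \<omega>. card (N \<omega> \<inter> D i)"
  have law: "prob {\<omega> \<in> space M. card (N \<omega> \<inter> C) = n} =
      measure \<Lambda> C ^ n / fact n * exp (- measure \<Lambda> C)" if "C \<in> sets borel" "bounded C" for C n
    using ppp that by (auto simp: poisson_point_process_def)
  have "disjoint_family_on D {..<2}"
    using disj by (auto simp: disjoint_family_on_def D_def)
  moreover have "\<forall>i<2. D i \<in> sets borel \<and> bounded (D i)"
    using Q B by (auto simp: D_def)
  ultimately have "indep_vars (\<lambda>_. count_space UNIV) ?X {..<2}"
    using ppp unfolding poisson_point_process_def by blast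
  then have "prob (\<Inter>i\<in>{..<2}. ?X i -` A i \<inter> space M) =
      (\<Prod>i\<in>{..<2}. prob (?X i -` A i \<inter> space M))"
    by (rule indep_varsD) (auto simp: lessThan_empty_iff)
  moreover have "(\<Inter>i\<in>{..<2}. ?X i -` A i \<inter> space M) =
      {\<omega> \<in> space M. card (N \<omega> \<inter> Q) = 1 \<and> card (N \<omega> \<inter> B) = 0}"
    by (auto simp: D_def A_def numeral_2_eq_2 lessThan_Suc)
  moreover have "?X 0 -` A 0 \<inter> space M = {\<omega> \<in> space M. card (N \<omega> \<inter> Q) = 1}"
    by (auto simp: D_def A_def)
  moreover have "?X 1 -` A 1 \<inter> space M = {\<omega> \<in> space M. card (N \<omega> \<inter> B) = 0}"
    by (auto simp: D_def A_def)
  ultimately show ?thesis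
    using law[OF Q, of 1] law[OF B, of 0] by (simp add: numeral_2_eq_2 lessThan_Suc)
qed

text \<open>For \<open>U\<close> cut off by balls, independence gives an exact product, and the void
  factor is at least \<open>exp (- u)\<close> uniformly in the radius. Continuity from above carries
  the bound to the full \<open>U\<close>, which may be unbounded.\<close>

lemma ppp_one_none_prob:
  assumes Q: "Q \<in> sets borel" "bounded Q" and U: "U \<in> sets borel"
    and disj: "Q \<inter> U = {}" and u: "0 \<le> u" "emeasure \<Lambda> U \<le> ennreal u"
  shows "measure M {\<omega> \<in> space M. card (N \<omega> \<inter> Q) = 1 \<and> N \<omega> \<inter> U = {}}
    \<ge> measure \<Lambda> Q * exp (- measure \<Lambda> Q) * exp (- u)"
proof -
  interpret prob_space M by (rule ppp_prob_space)
  define B where "B = (\<lambda>n::nat. U \<inter> cball 0 (real n))"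
  have B: "B n \<in> sets borel" "bounded (B n)" "Q \<inter> B n = {}" for n
    using U disj by (auto simp: B_def intro: bounded_Int)
  define E where "E = (\<lambda>n. {\<omega> \<in> space M. card (N \<omega> \<inter> Q) = 1 \<and> card (N \<omega> \<inter> B n) = 0})"
  have E_sets: "E n \<in> sets M" for n
    unfolding E_def by (intro sets.sets_Collect_conj ppp_card_sets Q B)
  have fin: "finite (N \<omega> \<inter> B n)" if "\<omega> \<in> space M" for \<omega> n
    using ppp_locally_finite that B by auto
  have "decseq E"
    unfolding decseq_def
  proof (intro allI impI)
    fix m n :: nat assume "m \<le> n"
    then have "B m \<subseteq> B n" by (auto simp: B_def)
    then show "E n \<subseteq> E m" using fin by (fastforce simp: E_def card_eq_0_iff)
  qed
  then have "(\<lambda>n. prob (E n)) \<longlonglongrightarrow> prob (\<Inter>n. E n)"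
    using E_sets by (intro finite_Lim_measure_decseq) auto
  moreover have "(\<Inter>n. E n) = {\<omega> \<in> space M. card (N \<omega> \<inter> Q) = 1 \<and> N \<omega> \<inter> U = {}}"
    using ppp_disjnt_iff[of _ U] by (simp add: E_def B_def set_eq_iff) blast
  moreover have "measure \<Lambda> Q * exp (- measure \<Lambda> Q) * exp (- u) \<le> prob (E n)" for n
  proof -
    have "emeasure \<Lambda> (B n) \<le> emeasure \<Lambda> U"
      using U by (intro emeasure_mono) (auto simp: ppp_sets B_def)
    then have "emeasure \<Lambda> (B n) \<le> ennreal u" using u by (auto intro: order_trans)
    then have "measure \<Lambda> (B n) \<le> u"
      using u(1) by (metis enn2real_mono enn2real_ennreal ennreal_less_top measure_def)
    then show ?thesis
      unfolding E_def ppp_one_none_prob_bounded[OF Q B] by (intro mult_left_mono) auto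
  qed
  ultimately show ?thesis
    by (metis (no_types, lifting) LIMSEQ_le_const)
qed

end

section \<open>Measurability of the number of maxima\<close>

context
  fixes M :: "'w measure" and \<Lambda> :: "(real ^ 'n) measure" and N :: "'w \<Rightarrow> (real ^ 'n) set"
  assumes ppp: "poisson_point_process M \<Lambda> N"
begin

text \<open>
  The witness \<open>d\<close> of \<open>y \<prec> d \<prec> z\<close> ranges over a countable dense set, which turns the quantification
  over the random points \<open>y\<close> and \<open>z\<close> into a countable one.
\<close>

lemma ppp_isolated_maximum_sets:
  assumes B: "open B" "bounded B"
  shows "{\<omega> \<in> space M. card (N \<omega> \<inter> B) = 1 \<and> N \<omega> \<inter> B \<subseteq> maxima (N \<omega>)} \<in> sets M"
proof -
  obtain D :: "(real ^ 'n) set" where D: "countable D"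
    and dense: "\<And>X. open X \<Longrightarrow> X \<noteq> {} \<Longrightarrow> \<exists>d\<in>D. d \<in> X"
    using countable_dense_exists by blast
  have "{\<omega> \<in> space M. card (N \<omega> \<inter> B) = 1 \<and> N \<omega> \<inter> B \<subseteq> maxima (N \<omega>)} =
      {\<omega> \<in> space M. card (N \<omega> \<inter> B) = 1 \<and>
        (\<forall>d\<in>D. card (N \<omega> \<inter> (B \<inter> {y. y \<prec> d})) = 0 \<or> N \<omega> \<inter> {z. d \<prec> z} = {})}"
  proof (rule Collect_cong, rule conj_cong[OF refl], rule conj_cong[OF refl])
    fix \<omega> assume \<omega>: "\<omega> \<in> space M"
    have fin: "finite (N \<omega> \<inter> (B \<inter> {y. y \<prec> d}))" for d
      by (intro ppp_locally_finite[OF ppp] \<omega> bounded_Int disjI1 B)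
    have "N \<omega> \<inter> B \<subseteq> maxima (N \<omega>) \<longleftrightarrow> \<not> (\<exists>y\<in>N \<omega> \<inter> B. \<exists>z\<in>N \<omega>. y \<prec> z)"
      by (auto simp: maxima_def)
    also have "\<dots> \<longleftrightarrow> \<not> (\<exists>y\<in>N \<omega> \<inter> B. \<exists>z\<in>N \<omega>. \<exists>d\<in>D. y \<prec> d \<and> d \<prec> z)"
    proof -
      have "(\<exists>d\<in>D. y \<prec> d \<and> d \<prec> z) \<longleftrightarrow> y \<prec> z" for y z
        using dense[of "{d. y \<prec> d} \<inter> {d. d \<prec> z}"] dominated_between[of y z]
        by (auto intro: dominated_trans open_Int open_dominating open_dominated)
      then show ?thesis by simp
    qed
    also have "\<dots> \<longleftrightarrow>
        (\<forall>d\<in>D. card (N \<omega> \<inter> (B \<inter> {y. y \<prec> d})) = 0 \<or> N \<omega> \<inter> {z. d \<prec> z} = {})"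
      using fin by (auto simp: card_eq_0_iff)
    finally show "N \<omega> \<inter> B \<subseteq> maxima (N \<omega>) \<longleftrightarrow>
        (\<forall>d\<in>D. card (N \<omega> \<inter> (B \<inter> {y. y \<prec> d})) = 0 \<or> N \<omega> \<inter> {z. d \<prec> z} = {})" .
  qed
  also have "\<dots> \<in> sets M"
    using B by (intro sets.sets_Collect_conj sets.sets_Collect_countable_All'[OF _ D]
        sets.sets_Collect_disj ppp_card_sets[OF ppp] ppp_disjnt_sets[OF ppp])
      (auto intro: bounded_Int borel_dominated)
  finally show ?thesis .
qed

text \<open>By local finiteness, \<open>k\<close> maxima in \<open>G\<close> can be enclosed in
  \<open>k\<close> bounded basis sets inside \<open>G\<close>, each containing no other point of the
  process. Conversely, \<open>k\<close> basis sets that each isolate a maximum, with no point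
  shared, exhibit \<open>k\<close> maxima. There are only countably many such families, so the event
  is built countably from events already known to be measurable.\<close>

lemma ppp_count_maxima_sets:
  assumes "open G"
  shows "{\<omega> \<in> space M. enat k \<le> ext_card (maxima (N \<omega>) \<inter> G)} \<in> sets M"
proof -
  obtain BB :: "(real ^ 'n) set set" where cBB: "countable BB" and BB: "topological_basis BB"
    using ex_countable_basis by blast
  define \<B> where "\<B> = {B \<in> BB. bounded B \<and> B \<subseteq> G}"
  have \<B>: "open B" "bounded B" "B \<subseteq> G" if "B \<in> \<B>" for B
    using that BB by (auto simp: \<B>_def topological_basis_open)
  define \<F> where "\<F> = {F. finite F \<and> F \<subseteq> \<B>} \<inter> {F. card F = k}"
  have c\<F>: "countable \<F>"
    unfolding \<F>_def using cBB
    by (intro countable_Int1 countable_Collect_finite_subset) (simp add: \<B>_def)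
  define iso where "iso = (\<lambda>\<omega> B. card (N \<omega> \<inter> B) = 1 \<and> N \<omega> \<inter> B \<subseteq> maxima (N \<omega>))"
  \<comment> \<open>Distinct basis sets may overlap; what must be excluded is a common point of the
    process, which would be counted twice.\<close>
  define sep where "sep = (\<lambda>\<omega> B B'. B = B' \<or> card (N \<omega> \<inter> (B \<inter> B')) = 0)"
  have "{\<omega> \<in> space M. enat k \<le> ext_card (maxima (N \<omega>) \<inter> G)} =
      {\<omega> \<in> space M. \<exists>F\<in>\<F>. (\<forall>B\<in>F. iso \<omega> B) \<and> (\<forall>B\<in>F. \<forall>B'\<in>F. sep \<omega> B B')}"
  proof (rule Collect_cong, rule conj_cong[OF refl])
    fix \<omega> assume \<omega>: "\<omega> \<in> space M"
    note fin = ppp_locally_finite[OF ppp \<omega>]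
    show "enat k \<le> ext_card (maxima (N \<omega>) \<inter> G) \<longleftrightarrow>
      (\<exists>F\<in>\<F>. (\<forall>B\<in>F. iso \<omega> B) \<and> (\<forall>B\<in>F. \<forall>B'\<in>F. sep \<omega> B B'))"
    proof
      assume "enat k \<le> ext_card (maxima (N \<omega>) \<inter> G)"
      then obtain Y where Y: "Y \<subseteq> maxima (N \<omega>) \<inter> G" "finite Y" "card Y = k"
        unfolding ext_card_ge_iff by blast
      have "\<exists>B\<in>\<B>. N \<omega> \<inter> B = {y}" if "y \<in> Y" for y
      proof -
        have y: "y \<in> N \<omega>" "y \<in> G" using that Y by (auto simp: maxima_def)
        obtain e where e: "e > 0" "\<And>z. z \<in> N \<omega> \<inter> ball y 1 \<Longrightarrow> z \<noteq> y \<Longrightarrow> e \<le> dist y z"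
          using finite_set_avoid[OF fin[OF bounded_ball], of y 1 y] by auto
        \<comment> \<open>The cap at radius 1 keeps the ball inside the region where
          \<open>e\<close> bounds the distance from \<open>y\<close> to the other points.\<close>
        have "open (ball y (min e 1) \<inter> G)" "y \<in> ball y (min e 1) \<inter> G"
          using e y assms by auto
        then obtain B where B: "B \<in> BB" "y \<in> B" "B \<subseteq> ball y (min e 1) \<inter> G"
          using topological_basisE[OF BB] by metis
        then have "bounded B" using bounded_subset[OF bounded_ball] by blast
        moreover have "N \<omega> \<inter> B = {y}" using B y e(2) by fastforce
        ultimately show ?thesis using B by (auto simp: \<B>_def)
      qed
      then obtain b where b: "\<And>y. y \<in> Y \<Longrightarrow> b y \<in> \<B> \<and> N \<omega> \<inter> b y = {y}" by metis
      have "inj_on b Y" by (rule inj_onI) (metis b singleton_inject)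
      then have "b ` Y \<in> \<F>" using Y b by (auto simp: \<F>_def card_image)
      moreover have "iso \<omega> (b y)" if "y \<in> Y" for y
        using b[OF that] Y that by (auto simp: iso_def)
      moreover have "sep \<omega> (b y) (b y')" if "y \<in> Y" "y' \<in> Y" for y y'
      proof (cases "y = y'")
        case False
        have "N \<omega> \<inter> (b y \<inter> b y') = (N \<omega> \<inter> b y) \<inter> (N \<omega> \<inter> b y')" by blast
        also have "\<dots> = {}" using b that False by simp
        finally show ?thesis by (simp add: sep_def)
      qed (simp add: sep_def)
      ultimately show "\<exists>F\<in>\<F>. (\<forall>B\<in>F. iso \<omega> B) \<and> (\<forall>B\<in>F. \<forall>B'\<in>F. sep \<omega> B B')"
        by (intro bexI[of _ "b ` Y"]) auto
    next
      assume "\<exists>F\<in>\<F>. (\<forall>B\<in>F. iso \<omega> B) \<and> (\<forall>B\<in>F. \<forall>B'\<in>F. sep \<omega> B B')"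
      then obtain F where F: "F \<in> \<F>" "\<And>B. B \<in> F \<Longrightarrow> iso \<omega> B"
        "\<And>B B'. B \<in> F \<Longrightarrow> B' \<in> F \<Longrightarrow> sep \<omega> B B'" by blast
      have "\<exists>y. N \<omega> \<inter> B = {y}" if "B \<in> F" for B
        using F(2)[OF that] by (auto simp: iso_def card_1_singleton_iff)
      then obtain p where p: "\<And>B. B \<in> F \<Longrightarrow> N \<omega> \<inter> B = {p B}" by metis
      have "inj_on p F"
      proof (rule inj_onI, rule ccontr)
        fix B B' assume B: "B \<in> F" "B' \<in> F" "p B = p B'" "B \<noteq> B'"
        have "bounded B" using B(1) F(1) \<B>(2) by (auto simp: \<F>_def)
        then have "finite (N \<omega> \<inter> (B \<inter> B'))" by (intro fin bounded_Int disjI1)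
        then have "N \<omega> \<inter> (B \<inter> B') = {}" using F(3)[OF B(1,2)] B(4) by (auto simp: sep_def)
        then show False using p[OF B(1)] p[OF B(2)] B(3) by auto
      qed
      moreover have "p B \<in> maxima (N \<omega>) \<inter> G" if "B \<in> F" for B
        using p[OF that] F(2)[OF that] \<B>(3)[of B] F(1) that by (auto simp: iso_def \<F>_def)
      ultimately show "enat k \<le> ext_card (maxima (N \<omega>) \<inter> G)"
        unfolding ext_card_ge_iff using F(1)
        by (intro exI[of _ "p ` F"]) (auto simp: \<F>_def card_image)
    qed
  qed
  also have "\<dots> \<in> sets M"
  proof (intro sets.sets_Collect_countable_Ex'[OF _ c\<F>] sets.sets_Collect_conj)
    fix F assume F: "F \<in> \<F>"
    then have cF: "countable F" and F\<B>: "F \<subseteq> \<B>"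
      by (auto simp: \<F>_def countable_finite)
    show "{\<omega> \<in> space M. \<forall>B\<in>F. iso \<omega> B} \<in> sets M"
      unfolding iso_def using F\<B> \<B>
      by (intro sets.sets_Collect_countable_All'[OF _ cF] ppp_isolated_maximum_sets) auto
    show "{\<omega> \<in> space M. \<forall>B\<in>F. \<forall>B'\<in>F. sep \<omega> B B'} \<in> sets M"
      unfolding sep_def
    proof (intro sets.sets_Collect_countable_All'[OF _ cF])
      fix B B' assume "B \<in> F" "B' \<in> F"
      then have "B \<inter> B' \<in> sets borel" "bounded (B \<inter> B')"
        using F\<B> \<B> by (blast intro: borel_open open_Int bounded_Int)+
      then show "{\<omega> \<in> space M. B = B' \<or> card (N \<omega> \<inter> (B \<inter> B')) = 0} \<in> sets M"
        by (rule ppp_card_sets[OF ppp, where P = "\<lambda>n. B = B' \<or> n = 0"])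
    qed
  qed
  finally show ?thesis .
qed

lemma ppp_K_count_sets: "{\<omega> \<in> space M. enat k \<le> K_count g (N \<omega>)} \<in> sets M"
proof -
  have "K_count g S = ext_card (maxima S \<inter> {y. y \<prec> diag_point g})" for S :: "(real ^ 'n) set"
    by (simp add: K_count_def Int_def)
  then show ?thesis
    using ppp_count_maxima_sets[OF open_dominated] by simp
qed

end

section \<open>Mass of the intensity above a corner and in a unit box\<close>

lemma Basis_vec_real: "(Basis :: (real ^ 'n) set) = range (\<lambda>j. axis j 1)"
  by (auto simp: Basis_vec_def)

text \<open>Links the coordinates to \<open>Basis\<close>, over which Lebesgue integrals of products
  factorise.\<close>

lemma coord_sum_Basis: "coord_sum z = (\<Sum>b\<in>Basis. z \<bullet> b)"
  unfolding coord_sum_def Basis_vec_real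
  by (subst sum.reindex) (auto simp: inj_on_def axis_eq_axis inner_axis)

lemma dominated_Basis: "a \<prec> z \<Longrightarrow> b \<in> Basis \<Longrightarrow> a \<bullet> b < z \<bullet> b"
  by (auto simp: dominated_def Basis_vec_real inner_axis)

lemma borel_measurable_coord_sum [measurable]: "coord_sum \<in> borel_measurable borel"
  unfolding coord_sum_Basis[abs_def] by measurable

lemma borel_measurable_intensity:
  "(\<lambda>z :: real ^ 'n. ennreal (indicator {z. \<not> diag_point g \<prec> z} z * exp (- coord_sum z)))
    \<in> borel_measurable lborel"
proof -
  have [measurable]: "{z :: real ^ 'n. \<not> diag_point g \<prec> z} \<in> sets borel"
    using borel_comp[OF borel_dominated(1)[of "diag_point g"]] by (simp add: Compl_eq)
  show ?thesis by measurable
qed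

lemma emeasure_intensity:
  assumes "A \<in> sets borel"
  shows "emeasure (intensity g) A =
    (\<integral>\<^sup>+ z. ennreal (indicator {z. \<not> diag_point g \<prec> z} z * exp (- coord_sum z)) * indicator A z \<partial>lborel)"
  unfolding intensity_def using assms
  by (intro emeasure_density borel_measurable_intensity) auto

lemma nn_integral_exp_tail:
  "(\<integral>\<^sup>+ x. ennreal (exp (- x)) * indicator {c ..} x \<partial>lborel) = ennreal (exp (- c :: real))"
proof -
  have "((\<lambda>x :: real. - exp (- x)) \<longlongrightarrow> - 0) at_top"
    by (intro tendsto_minus filterlim_compose[OF exp_at_bot filterlim_uminus_at_bot_at_top])
  then show ?thesis
    by (subst nn_integral_FTC_atLeast[where F = "\<lambda>x. - exp (- x)" and T = 0])
      (auto intro!: derivative_eq_intros)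
qed

text \<open>Dropping the indicator in the density only increases the mass; what remains is a product
  of one-dimensional exponential tails.\<close>

lemma emeasure_intensity_upset_le:
  fixes a :: "real ^ 'n"
  shows "emeasure (intensity g) {z. a \<prec> z} \<le> ennreal (exp (- coord_sum a))"
proof -
  have "emeasure (intensity g) {z. a \<prec> z} \<le>
      (\<integral>\<^sup>+ z. (\<Prod>b\<in>Basis. ennreal (exp (- (z \<bullet> b))) * indicator {a \<bullet> b ..} (z \<bullet> b)) \<partial>lborel)"
    unfolding emeasure_intensity[OF borel_dominated(1)]
  proof (intro nn_integral_mono)
    fix z :: "real ^ 'n"
    show "ennreal (indicator {z. \<not> diag_point g \<prec> z} z * exp (- coord_sum z)) *
        indicator {z. a \<prec> z} z
      \<le> (\<Prod>b\<in>Basis. ennreal (exp (- (z \<bullet> b))) * indicator {a \<bullet> b ..} (z \<bullet> b))"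
    proof (cases "a \<prec> z")
      case True
      have "(\<Prod>b\<in>Basis. ennreal (exp (- (z \<bullet> b))) * indicator {a \<bullet> b ..} (z \<bullet> b)) =
          (\<Prod>b\<in>Basis. ennreal (exp (- (z \<bullet> b))))"
        using dominated_Basis[OF True] by (intro prod.cong) (auto simp: less_imp_le)
      also have "\<dots> = ennreal (exp (- coord_sum z))"
        by (simp add: prod_ennreal coord_sum_Basis exp_sum flip: sum_negf)
      finally show ?thesis
        by (auto simp: indicator_def intro!: ennreal_leI)
    qed simp
  qed
  also have "\<dots> = (\<Prod>b\<in>Basis. \<integral>\<^sup>+ x. ennreal (exp (- x)) * indicator {a \<bullet> b ..} x \<partial>lborel)"
    by (intro nn_integral_lborel_prod) auto
  also have "\<dots> = ennreal (exp (- coord_sum a))"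
    by (simp add: nn_integral_exp_tail prod_ennreal coord_sum_Basis exp_sum flip: sum_negf)
  finally show ?thesis .
qed

definition unit_box :: "real ^ 'n \<Rightarrow> (real ^ 'n) set"
  where "unit_box a = box a (\<chi> j. a $ j + 1)"

lemma mem_unit_box: "z \<in> unit_box a \<longleftrightarrow> (\<forall>j. a $ j < z $ j \<and> z $ j < a $ j + 1)"
  by (simp add: unit_box_def mem_box_cart)

lemma unit_box_borel: "unit_box a \<in> sets borel"
  and unit_box_bounded: "bounded (unit_box a)"
  by (auto simp: unit_box_def bounded_box)

lemma unit_box_dominating: "z \<in> unit_box a \<Longrightarrow> a \<prec> z"
  by (simp add: mem_unit_box dominated_def)

lemma emeasure_lborel_unit_box: "emeasure lborel (unit_box (a :: real ^ 'n)) = 1"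
proof -
  have "((\<chi> j. a $ j + 1) - a) \<bullet> b = 1" if "b \<in> Basis" for b :: "real ^ 'n"
    using that by (auto simp: Basis_vec_real inner_axis)
  then show ?thesis
    unfolding unit_box_def
    by (subst emeasure_lborel_box) (auto simp: Basis_vec_real inner_axis)
qed

text \<open>The box has volume 1, and inside it the coordinate sum exceeds that of the corner by at
  most the dimension. Lying below \<open>diag_point g\<close>, the box avoids the region where the
  intensity is cut to 0.\<close>

lemma emeasure_intensity_unit_box_ge:
  fixes a :: "real ^ 'n"
  assumes "\<And>z. z \<in> unit_box a \<Longrightarrow> z \<prec> diag_point g"
  shows "ennreal (exp (- coord_sum a - real CARD('n))) \<le> emeasure (intensity g) (unit_box a)"
proof -
  have "ennreal (exp (- coord_sum a - real CARD('n))) =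
      (\<integral>\<^sup>+ z. ennreal (exp (- coord_sum a - real CARD('n))) * indicator (unit_box a) z \<partial>lborel)"
    using unit_box_borel[of a] by (simp add: nn_integral_cmult_indicator emeasure_lborel_unit_box)
  also have "\<dots> \<le> emeasure (intensity g) (unit_box a)"
    unfolding emeasure_intensity[OF unit_box_borel]
  proof (intro nn_integral_mono)
    fix z :: "real ^ 'n"
    show "ennreal (exp (- coord_sum a - real CARD('n))) * indicator (unit_box a) z \<le>
        ennreal (indicator {z. \<not> diag_point g \<prec> z} z * exp (- coord_sum z)) * indicator (unit_box a) z"
    proof (cases "z \<in> unit_box a")
      case True
      then have "coord_sum z \<le> (\<Sum>j\<in>UNIV. a $ j + 1)"
        unfolding coord_sum_def by (intro sum_mono) (auto simp: mem_unit_box less_imp_le)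
      then have "coord_sum z \<le> coord_sum a + real CARD('n)"
        by (simp add: coord_sum_def sum.distrib)
      moreover have "\<not> diag_point g \<prec> z"
        using assms[OF True] dominated_trans not_dominated_self by blast
      ultimately show ?thesis using True by (auto intro!: ennreal_leI)
    qed simp
  qed
  finally show ?thesis .
qed

section \<open>Many maxima from lone points in disjoint boxes\<close>

text \<open>Whatever dominates the lone point also dominates the corner, hence would have to be the
  lone point itself.\<close>

lemma lone_point_maximum:
  assumes "card (S \<inter> unit_box a) = 1" "S \<inter> ({z. a \<prec> z} - unit_box a) = {}"
  shows "\<exists>y. y \<in> maxima S \<and> y \<in> unit_box a"
proof -
  obtain y where y: "S \<inter> unit_box a = {y}"
    using assms(1) by (auto simp: card_1_singleton_iff)
  have "\<not> y \<prec> z" if "z \<in> S" for z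
  proof
    assume yz: "y \<prec> z"
    then have "a \<prec> z" using y unit_box_dominating dominated_trans by blast
    then have "z = y" using assms(2) y that by blast
    then show False using yz not_dominated_self by blast
  qed
  then show ?thesis using y by (auto simp: maxima_def)
qed

text \<open>
  No second moment is needed for the lower tail of the number \<open>X\<close> of boxes that hold a lone point
  with nothing else above the corner: \<open>X \<le> card I\<close> and \<open>\<E> X \<ge> p * card I\<close> already force
  \<open>P (X \<ge> p * card I / 2) \<ge> p / 2\<close>.
\<close>

lemma K_count_prob_ge:
  fixes N :: "'w \<Rightarrow> (real ^ 'n) set" and I :: "(real ^ 'n) set"
  defines "p \<equiv> exp (- real CARD('n) - 2)"
  assumes ppp: "poisson_point_process M (intensity g) N"
    and I: "finite I" "disjoint_family_on unit_box I"
    and zero: "\<And>a. a \<in> I \<Longrightarrow> coord_sum a = 0"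
    and below: "\<And>a z. a \<in> I \<Longrightarrow> z \<in> unit_box a \<Longrightarrow> z \<prec> diag_point g"
    and k: "2 * real k \<le> p * real (card I)" "0 < card I"
  shows "p / 2 \<le> measure M {\<omega> \<in> space M. enat k \<le> K_count g (N \<omega>)}"
proof -
  interpret prob_space M by (rule ppp_prob_space[OF ppp])
  define U where "U = (\<lambda>a :: real ^ 'n. {z. a \<prec> z} - unit_box a)"
  define A where "A = (\<lambda>a. {\<omega> \<in> space M. card (N \<omega> \<inter> unit_box a) = 1 \<and> N \<omega> \<inter> U a = {}})"
  define T where "T = {\<omega> \<in> space M. enat k \<le> K_count g (N \<omega>)}"
  have U_borel: "U a \<in> sets borel" for a
    unfolding U_def by (intro sets.Diff borel_dominated unit_box_borel)
  have A_sets: "A a \<in> sets M" for a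
    unfolding A_def
    by (intro ppp_one_none_sets[OF ppp] unit_box_borel unit_box_bounded U_borel)
  have T_sets: "T \<in> sets M" unfolding T_def by (rule ppp_K_count_sets[OF ppp])
  have sets_int: "sets (intensity g) = sets (borel :: (real ^ 'n) measure)"
    by (simp add: intensity_def)
  \<comment> \<open>Three factors make up \<open>p\<close>. The box has mass \<open>q\<close> with
    \<open>exp (- d) \<le> q\<close>, where \<open>d\<close> is the dimension. Since the corner has
    coordinate sum 0, everything above it has mass at most 1, so \<open>exp (- q)\<close> and the
    probability that \<open>U a\<close> is empty are each at least \<open>exp (- 1)\<close>.\<close>
  have prob_A: "p \<le> prob (A a)" if "a \<in> I" for a
  proof -
    have le1: "emeasure (intensity g) {z. a \<prec> z} \<le> ennreal 1"
      using emeasure_intensity_upset_le[of g a] zero[OF that] by simp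
    have sub: "unit_box a \<subseteq> {z. a \<prec> z}" "U a \<subseteq> {z. a \<prec> z}"
      using unit_box_dominating by (auto simp: U_def)
    have "emeasure (intensity g) (U a) \<le> emeasure (intensity g) {z. a \<prec> z}"
      "emeasure (intensity g) (unit_box a) \<le> emeasure (intensity g) {z. a \<prec> z}"
      using sub borel_dominated(1)[of a] by (auto intro!: emeasure_mono simp: sets_int)
    then have U1: "emeasure (intensity g) (U a) \<le> ennreal 1"
      and Q1: "emeasure (intensity g) (unit_box a) \<le> ennreal 1"
      using le1 by auto
    define q where "q = measure (intensity g) (unit_box a)"
    have q: "emeasure (intensity g) (unit_box a) = ennreal q"
      unfolding q_def using Q1 by (intro emeasure_eq_ennreal_measure) (auto simp: top_unique)
    have "q \<le> 1" using Q1 unfolding q by simp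
    moreover have "exp (- real CARD('n)) \<le> q"
      using emeasure_intensity_unit_box_ge[of a g] below[OF that] zero[OF that]
      unfolding q by (simp add: q_def)
    moreover have "0 \<le> q" by (simp add: q_def)
    ultimately have "exp (- real CARD('n)) * exp (- 1) * exp (- 1) \<le> q * exp (- q) * exp (- 1)"
      by (intro mult_mono) auto
    also have "\<dots> \<le> prob (A a)"
      unfolding A_def q_def using U1
      by (intro ppp_one_none_prob[OF ppp] unit_box_borel unit_box_bounded U_borel) (auto simp: U_def)
    finally show ?thesis by (simp add: p_def diff_diff_eq flip: exp_add)
  qed
  \<comment> \<open>On \<open>T\<close> the number of successful boxes is bounded trivially by
    \<open>card I\<close>. Off \<open>T\<close> it is at most \<open>k\<close>, because disjoint
    boxes yield distinct maxima below \<open>diag_point g\<close>.\<close>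
  have count: "(\<Sum>a\<in>I. indicator (A a) \<omega>) \<le> real k + real (card I) * indicator T \<omega>"
    if \<omega>: "\<omega> \<in> space M" for \<omega>
  proof (cases "\<omega> \<in> T")
    case True
    have "(\<Sum>a\<in>I. indicator (A a) \<omega> :: real) \<le> (\<Sum>a\<in>I. 1)"
      by (intro sum_mono) (auto simp: indicator_def)
    then show ?thesis using True by simp
  next
    case False
    define J where "J = {a \<in> I. \<omega> \<in> A a}"
    have "\<exists>y. y \<in> maxima (N \<omega>) \<and> y \<in> unit_box a" if "a \<in> J" for a
      using that by (intro lone_point_maximum) (auto simp: J_def A_def U_def)
    then obtain y where y: "\<And>a. a \<in> J \<Longrightarrow> y a \<in> maxima (N \<omega>) \<and> y a \<in> unit_box a"
      by metis
    have "inj_on y J"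
    proof (rule inj_onI, rule ccontr)
      fix a a' assume "a \<in> J" "a' \<in> J" "y a = y a'" "a \<noteq> a'"
      then show False
        using y[of a] y[of a'] I(2) unfolding disjoint_family_on_def J_def by fastforce
    qed
    then have "card (y ` J) = card J" by (rule card_image)
    moreover have "y ` J \<subseteq> {y \<in> maxima (N \<omega>). y \<prec> diag_point g}"
      using y below by (auto simp: J_def)
    ultimately have "enat (card J) \<le> K_count g (N \<omega>)"
      unfolding K_count_def ext_card_ge_iff using I(1)
      by (intro exI[of _ "y ` J"]) (auto simp: J_def)
    moreover have "\<not> enat k \<le> K_count g (N \<omega>)" using False \<omega> by (simp add: T_def)
    ultimately have "card J \<le> k"
      by (metis enat_ord_simps(1) nle_le order_trans)
    moreover have "(\<Sum>a\<in>I. indicator (A a) \<omega>) = real (card J)"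
      using I(1) by (simp add: indicator_def J_def sum.If_cases Int_def)
    ultimately show ?thesis using False by simp
  qed
  have "p * real (card I) \<le> (\<Sum>a\<in>I. prob (A a))"
    using sum_mono[of I "\<lambda>_. p" "\<lambda>a. prob (A a)"] prob_A by (simp add: mult.commute)
  also have "\<dots> = expectation (\<lambda>\<omega>. \<Sum>a\<in>I. indicator (A a) \<omega>)"
    using A_sets by (subst Bochner_Integration.integral_sum) (auto simp: emeasure_eq_measure)
  also have "\<dots> \<le> expectation (\<lambda>\<omega>. real k + real (card I) * indicator T \<omega>)"
    using A_sets T_sets count by (intro integral_mono) (auto simp: emeasure_eq_measure)
  also have "\<dots> = real k + real (card I) * prob T"
    using T_sets by (simp add: emeasure_eq_measure prob_space)
  finally have "p * real (card I) \<le> p * real (card I) / 2 + real (card I) * prob T"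
    using k(1) by linarith
  then have "real (card I) * (p / 2) \<le> real (card I) * prob T" by (simp add: field_simps)
  then show ?thesis using k(2) by (simp add: T_def)
qed

text \<open>
  Lattice points on the hyperplane \<open>coord_sum z = 0\<close>: all coordinates but one are chosen freely in
  \<open>{-L<..0}\<close>, and the remaining one balances the sum.
\<close>

lemma ex_unit_box_family:
  fixes L :: nat
  assumes L: "0 < L" and g: "real CARD('n) * (real CARD('n) * real L) \<le> g"
  obtains I :: "(real ^ 'n) set" where
    "finite I" "disjoint_family_on unit_box I" "card I = L ^ (CARD('n) - 1)"
    "\<And>a. a \<in> I \<Longrightarrow> coord_sum a = 0"
    "\<And>a z. a \<in> I \<Longrightarrow> z \<in> unit_box a \<Longrightarrow> z \<prec> diag_point g"
proof -
  fix j0 :: 'n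
  define F where "F = (UNIV - {j0}) \<rightarrow>\<^sub>E {..<L}"
  define c :: "('n \<Rightarrow> nat) \<Rightarrow> real ^ 'n" where
    "c = (\<lambda>f. \<chi> j. if j = j0 then \<Sum>i\<in>UNIV - {j0}. real (f i) else - real (f j))"
  \<comment> \<open>Distinct lattice points differ by at least 1 in some free coordinate, which is
    what makes the open unit boxes disjoint.\<close>
  have sep: "f = f'"
    if "f \<in> F" "f' \<in> F" "\<And>j. \<bar>c f $ j - c f' $ j\<bar> < 1" for f f'
  proof (rule PiE_ext[OF that(1,2)[unfolded F_def]])
    fix j assume "j \<in> UNIV - {j0}"
    then show "f j = f' j" using that(3)[of j] by (simp add: c_def)
  qed
  have inj: "inj_on c F" by (rule inj_onI) (auto intro: sep)
  have "card F = L ^ (CARD('n) - 1)"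
    unfolding F_def by (subst card_funcsetE) auto
  then have "card (c ` F) = L ^ (CARD('n) - 1)" by (simp add: card_image[OF inj])
  moreover have "finite (c ` F)"
    unfolding F_def by (intro finite_imageI finite_PiE) auto
  moreover have "disjoint_family_on unit_box (c ` F)"
    unfolding disjoint_family_on_def
  proof (intro ballI impI, rule ccontr)
    fix a a' assume aa': "a \<in> c ` F" "a' \<in> c ` F" "a \<noteq> a'" "unit_box a \<inter> unit_box a' \<noteq> {}"
    then obtain f f' z where f: "f \<in> F" "f' \<in> F" "a = c f" "a' = c f'"
      and z: "z \<in> unit_box a" "z \<in> unit_box a'" by blast
    have "\<bar>a $ j - a' $ j\<bar> < 1" for j
      using z[unfolded mem_unit_box] by (smt (verit))
    then show False using sep[OF f(1,2)] f aa'(3) by auto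
  qed
  moreover have "coord_sum a = 0" if "a \<in> c ` F" for a
    using that by (auto simp: coord_sum_def c_def sum.remove[of UNIV j0] sum_negf)
  moreover have "z \<prec> diag_point g" if az: "a \<in> c ` F" "z \<in> unit_box a" for a z
    unfolding dominated_def
  proof
    fix j
    obtain f where f: "f \<in> F" "a = c f" using az(1) by blast
    have dL: "1 \<le> real CARD('n)" "1 \<le> real L" using L by (simp_all add: Suc_le_eq)
    \<comment> \<open>The balancing coordinate is a sum of \<open>CARD('n) - 1\<close> terms of size
      at most \<open>L - 1\<close>; all others are at most 0. The second factor
      \<open>CARD('n)\<close> in the assumption on \<open>g\<close> compensates for the division in
      \<open>diag_point\<close>.\<close>
    have "a $ j + 1 \<le> real CARD('n) * real L"
    proof (cases "j = j0")
      case True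
      have "(\<Sum>i\<in>UNIV - {j0}. real (f i)) \<le> (\<Sum>i\<in>UNIV - {j0}. real L - 1)"
        using f(1) by (intro sum_mono) (auto simp: F_def PiE_iff dest!: bspec)
      also have "\<dots> = (real CARD('n) - 1) * (real L - 1)"
        by (simp add: of_nat_diff Suc_le_eq)
      finally have "a $ j \<le> (real CARD('n) - 1) * (real L - 1)"
        using True f(2) by (simp add: c_def)
      also have "\<dots> = real CARD('n) * real L - (real CARD('n) + real L - 1)"
        by (simp add: algebra_simps)
      finally show ?thesis using dL by linarith
    next
      case False
      have "1 * 1 \<le> real CARD('n) * real L" using dL by (intro mult_mono) auto
      then show ?thesis using False f(2) by (simp add: c_def)
    qed
    also have "\<dots> \<le> g / real CARD('n)" using g dL by (simp add: field_simps)
    finally show "z $ j < diag_point g $ j"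
      using az(2)[unfolded mem_unit_box, rule_format, of j] by (simp add: diag_point_def)
  qed
  ultimately show thesis by (intro that[of "c ` F"])
qed

section \<open>Gumbel mixture and choice of constants\<close>

text \<open>For nonnegative \<open>g\<close> the double exponential costs at most a factor
  \<open>exp (- 1)\<close>.\<close>

lemma gumbel_density_ge:
  assumes "0 \<le> g" "g \<le> b"
  shows "exp (- b - 1) \<le> gumbel_density g"
proof -
  have "exp (- g) \<le> 1" using assms by simp
  then have "- b - 1 \<le> - g + - exp (- g)" using assms by linarith
  then show ?thesis unfolding gumbel_density_def by (simp flip: exp_add)
qed

text \<open>The mixture is restricted to the window \<open>{b..b + 1}\<close> of length 1, where the
  Gumbel density is at least \<open>exp (- b - 2)\<close>. The integrand is compared from below with
  a step function, which is sound whatever its measurability in \<open>g\<close>.\<close>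

lemma has_K_law_prob_ge:
  fixes N :: "real \<Rightarrow> 'w \<Rightarrow> (real ^ 'n) set"
  assumes law: "has_K_law P K M N" and b: "0 \<le> b" and p: "0 \<le> p"
    and cond: "\<And>g. b \<le> g \<Longrightarrow> p \<le> measure (M g) {\<omega> \<in> space (M g). enat k \<le> K_count g (N g \<omega>)}"
  shows "p * exp (- b - 2) \<le> measure P {\<omega> \<in> space P. k \<le> K \<omega>}"
proof -
  interpret prob_space P using law by (simp add: has_K_law_def)
  have "ennreal (p * exp (- b - 2)) =
      (\<integral>\<^sup>+ g. ennreal (p * exp (- b - 2)) * indicator {b..b + 1} g \<partial>lborel)"
    by (simp add: nn_integral_cmult_indicator)
  also have "\<dots> \<le> (\<integral>\<^sup>+ g. emeasure (M g) {\<omega> \<in> space (M g). K_count g (N g \<omega>) \<ge> enat k}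
               * ennreal (gumbel_density g) \<partial>lborel)"
  proof (intro nn_integral_mono)
    fix g
    interpret Mg: prob_space "M g"
      using law by (auto simp: has_K_law_def poisson_point_process_def)
    show "ennreal (p * exp (- b - 2)) * indicator {b..b + 1} g \<le>
      emeasure (M g) {\<omega> \<in> space (M g). K_count g (N g \<omega>) \<ge> enat k} * ennreal (gumbel_density g)"
    proof (cases "g \<in> {b..b + 1}")
      case True
      then have "exp (- b - 2) \<le> gumbel_density g"
        using gumbel_density_ge[of g "b + 1"] b by (simp add: diff_diff_eq2 diff_diff_eq)
      then have "p * exp (- b - 2) \<le>
          Mg.prob {\<omega> \<in> space (M g). K_count g (N g \<omega>) \<ge> enat k} * gumbel_density g"
        using True cond[of g] p by (intro mult_mono) auto
      then show ?thesis
        using True by (simp add: Mg.emeasure_eq_measure gumbel_density_def ennreal_leI flip: ennreal_mult)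
    qed simp
  qed
  also have "\<dots> = ennreal (prob {\<omega> \<in> space P. k \<le> K \<omega>})"
    using law by (simp add: has_K_law_def flip: emeasure_eq_measure)
  finally show ?thesis by simp
qed

theorem theorem4p5:
  assumes "CARD('n::finite) \<ge> 2"
  shows "\<exists>(C::real) (k0::nat).
    \<forall>(P :: 'p measure) (K :: 'p \<Rightarrow> nat) (M :: real \<Rightarrow> 'w measure) (N :: real \<Rightarrow> 'w \<Rightarrow> (real ^ 'n) set).
      has_K_law P K M N \<longrightarrow>
      (\<forall>k\<ge>k0. measure P {\<omega> \<in> space P. K \<omega> \<ge> k}
                \<ge> exp (- C * real k powr (1 / (real CARD('n) - 1))))"
proof -
  define d where "d = real CARD('n)"
  define s where "s = 1 / (d - 1)"
  define p where "p = exp (- d - 2)"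
  \<comment> \<open>Chosen so that \<open>(c * k powr s) powr (d - 1) = 2 * k / p\<close>: a lattice
    of side at least \<open>c * k powr s\<close> then has the \<open>2 * k / p\<close> boxes
    required by \<open>K_count_prob_ge\<close>.\<close>
  define c where "c = (2 / p) powr s"
  \<comment> \<open>The first three summands absorb the factors \<open>p / 2\<close> and
    \<open>exp (- 2)\<close>; the last bounds the cost \<open>exp (- b)\<close> of reaching the
    window.\<close>
  define C where "C = d + 4 + ln 2 + d * (d * (c + 1))"
  have d: "2 \<le> d" using assms by (simp add: d_def)
  have p: "0 < p" by (simp add: p_def)
  have s: "0 < s" using d by (simp add: s_def)
  \<comment> \<open>Here \<open>k0 = 1\<close> suffices: from then on \<open>k powr s\<close> is at
    least 1 and absorbs the additive constants.\<close>
  have "exp (- C * real k powr s) \<le> measure P {\<omega> \<in> space P. k \<le> K \<omega>}"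
    if law: "has_K_law P K M N" and k: "1 \<le> k"
    for P :: "'p measure" and K and M :: "real \<Rightarrow> 'w measure"
      and N :: "real \<Rightarrow> 'w \<Rightarrow> (real ^ 'n) set" and k :: nat
  proof -
    define r where "r = real k powr s"
    define L where "L = nat \<lceil>c * r\<rceil>"
    \<comment> \<open>The least \<open>g\<close> for which \<open>ex_unit_box_family\<close> places
      the boxes of side count \<open>L\<close> below \<open>diag_point g\<close>.\<close>
    define b where "b = d * (d * real L)"
    have r: "1 \<le> r" unfolding r_def using k s by (intro ge_one_powr_ge_zero) auto
    have cr: "c * r = (2 * real k / p) powr s"
      unfolding c_def r_def using p by (simp add: powr_mult[symmetric])
    have cr_pos: "0 < c * r" unfolding cr using p k by simp
    have L: "c * r \<le> real L" "real L \<le> c * r + 1" "0 < L"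
      using cr_pos unfolding L_def by linarith+
    have "2 * real k / p = (c * r) powr (d - 1)"
      unfolding cr powr_powr using d k p by (simp add: s_def)
    also have "\<dots> \<le> real L powr (d - 1)"
      using L cr_pos d by (intro powr_mono2) auto
    also have "\<dots> = real (L ^ (CARD('n) - 1))"
      using L(3) assms by (simp add: d_def powr_realpow[symmetric] of_nat_diff)
    finally have kL: "2 * real k \<le> p * real (L ^ (CARD('n) - 1))"
      using p by (simp add: field_simps)
    have "p / 2 \<le> measure (M g) {\<omega> \<in> space (M g). enat k \<le> K_count g (N g \<omega>)}" if "b \<le> g" for g
    proof -
      obtain I :: "(real ^ 'n) set" where I: "finite I" "disjoint_family_on unit_box I"
        "card I = L ^ (CARD('n) - 1)" "\<And>a. a \<in> I \<Longrightarrow> coord_sum a = 0"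
        "\<And>a z. a \<in> I \<Longrightarrow> z \<in> unit_box a \<Longrightarrow> z \<prec> diag_point g"
        using ex_unit_box_family[OF L(3), of g] \<open>b \<le> g\<close> unfolding b_def d_def by metis
      show ?thesis
        unfolding p_def d_def
      proof (rule K_count_prob_ge[of "M g" g "N g" I])
        show "poisson_point_process (M g) (intensity g) (N g)"
          using law by (simp add: has_K_law_def)
      qed (use I kL L(3) in \<open>auto simp: p_def d_def\<close>)
    qed
    then have "p / 2 * exp (- b - 2) \<le> measure P {\<omega> \<in> space P. k \<le> K \<omega>}"
      using p d by (intro has_K_law_prob_ge[OF law]) (auto simp: b_def)
    moreover have "p / 2 * exp (- b - 2) = exp (- (d + 4 + ln 2 + b))"
    proof -
      have "exp (- (d + 4 + ln 2 + b)) = exp (- d - 2) * exp (- ln 2) * exp (- b - 2)"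
        by (simp flip: exp_add)
      then show ?thesis by (simp add: p_def exp_minus field_simps)
    qed
    moreover have "d + 4 + ln 2 + b \<le> C * r"
    proof -
      \<comment> \<open>The 1 lost by rounding up to \<open>L\<close> is at most
        \<open>r\<close>.\<close>
      have "real L \<le> (c + 1) * r" using L(2) r by (simp add: algebra_simps)
      then have "b \<le> d * (d * ((c + 1) * r))"
        unfolding b_def using d by (intro mult_left_mono) auto
      moreover have "(d + 4 + ln 2) * 1 \<le> (d + 4 + ln 2) * r"
        using r d by (intro mult_left_mono) auto
      ultimately show ?thesis by (simp add: C_def algebra_simps)
    qed
    ultimately show ?thesis unfolding r_def[symmetric] by (smt (verit) exp_le_cancel_iff mult_minus_left)
  qed
  then show ?thesis unfolding s_def d_def by blast
qed

end
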